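(* Let $G=\langle a,t\rangle$ be the Fabrykowski-Gupta group, and let $\gamma(n)$ denote the number of elements of $G$ expressible as a product of at most $n$ generators (elements of $\{a^{\pm1},t^{\pm1}\}$). Then $G$ has intermediate growth (that is, $\gamma$ grows faster than every polynomial and slower than every exponential $C^n$, $C>1$). More precisely, $$e^{n^{\frac{\log 3}{\log 6}}}\lesssim \gamma(n)\lesssim e^{\frac{n(\log\log n)^2}{\log n}}.$$
   Context: The Fabrykowski-Gupta group: let $A=\mathbb{Z}/3\mathbb{Z}=\{0,1,2\}$, and let $A^*$ be the set of finite words over $A$, viewed as the vertex set of the $3$-regular rooted tree. Let $a$ be the automorphism of the tree cyclically permuting the first-level subtrees, $a(xw)=(x+1)w$ for $x\in A$, $w\in A^*$. Let $t$ be the automorphism defined recursively by $t=\langle\langle a,1,t\rangle\rangle$, i.e. $t(0w)=0\,a(w)$, $t(1w)=1w$, $t(2w)=2\,t(w)$ for $w\in A^*$. Then $G=\langle a,t\rangle\le \mathrm{Aut}(A^* )$. Notation: for two functions $f,g$, write $f\lesssim g$ if there is a constant $A>0$ such that $f(n)\le g(An)$ for all sufficiently large $n$ (in particular large enough for the expressions to be defined); the functions given by formulas are regarded as functions of a real variable. *)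

theory Defs
  imports Complex_Main "HOL-Algebra.Elementary_Groups" "HOL-Library.Numeral_Type"
    "HOL-Library.Landau_Symbols"
begin

text \<open>The alphabet \<open>\<int>/3\<int>\<close> is the three-element ring \<open>3\<close> of \<open>Numeral_Type\<close>, so that
  addition of letters is modulo 3. Words are the vertices of the rooted tree; the root is the
  empty word and the head of a list is the first-level letter.\<close>

type_synonym vertex = "3 list"

definition adjacent :: "vertex \<Rightarrow> vertex \<Rightarrow> bool" where
  "adjacent u v \<longleftrightarrow> (\<exists>x. v = u @ [x]) \<or> (\<exists>x. u = v @ [x])"

definition tree_aut :: "(vertex \<Rightarrow> vertex) set" where
  "tree_aut = {f. bij f \<and> f [] = [] \<and> (\<forall>u v. adjacent (f u) (f v) \<longleftrightarrow> adjacent u v)}"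

definition Aut :: "(vertex \<Rightarrow> vertex) monoid" where
  "Aut = \<lparr>carrier = tree_aut, mult = (\<circ>), one = id\<rparr>"

primrec fg_a :: "vertex \<Rightarrow> vertex" where
  "fg_a [] = []"
| "fg_a (x # w) = (x + 1) # w"

text \<open>The final branch is the case \<open>x = 2\<close>; see \<open>fg_t_Cons\<close> below.\<close>

primrec fg_t :: "vertex \<Rightarrow> vertex" where
  "fg_t [] = []"
| "fg_t (x # w) = x # (if x = 0 then fg_a w else if x = 1 then w else fg_t w)"

definition Fabrykowski_Gupta :: "(vertex \<Rightarrow> vertex) monoid" where
  "Fabrykowski_Gupta = subgroup_generated Aut {fg_a, fg_t}"

definition growth :: "('a, 'b) monoid_scheme \<Rightarrow> 'a set \<Rightarrow> nat \<Rightarrow> nat" where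
  "growth G S n =
     card {foldr (mult G) ws (one G) | ws. set ws \<subseteq> S \<union> m_inv G ` S \<and> length ws \<le> n}"

definition intermediate_growth :: "(nat \<Rightarrow> nat) \<Rightarrow> bool" where
  "intermediate_growth \<gamma> \<longleftrightarrow>
     (\<forall>d::nat. (\<lambda>n. real n ^ d) \<in> o(\<lambda>n. real (\<gamma> n))) \<and>
     (\<forall>C>1. (\<lambda>n. real (\<gamma> n)) \<in> o(\<lambda>n. C ^ n))"

definition lesssim :: "(real \<Rightarrow> real) \<Rightarrow> (real \<Rightarrow> real) \<Rightarrow> bool" (infix "\<lesssim>" 50) where
  "f \<lesssim> g \<longleftrightarrow> (\<exists>A>0. \<forall>\<^sub>F x in at_top. f x \<le> g (A * x))"

text \<open>To make sense of \<open>\<gamma>(A n)\<close> for a real constant \<open>A\<close>, a growth function is read at a real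
  argument \<open>x \<ge> 0\<close> as the number of products of at most \<open>x\<close> generators, that is, of at most
  \<open>\<lfloor>x\<rfloor>\<close> generators.\<close>

definition real_arg :: "(nat \<Rightarrow> nat) \<Rightarrow> real \<Rightarrow> real" where
  "real_arg \<gamma> x = real (\<gamma> (nat \<lfloor>x\<rfloor>))"

text \<open>Sanity checks: \<open>Aut\<close> is a group containing \<open>fg_a\<close> and \<open>fg_t\<close>. The latter matters
  because \<open>subgroup_generated\<close> discards generators outside the carrier.\<close>

lemma fg_t_Cons: "fg_t (0 # w) = 0 # fg_a w" "fg_t (1 # w) = 1 # w" "fg_t (2 # w) = 2 # fg_t w"
  by simp_all

lemma group_Aut: "group Aut"
proof (rule groupI)
  fix f assume "f \<in> carrier Aut"
  then have f: "bij f" "f [] = []" "\<And>u v. adjacent (f u) (f v) \<longleftrightarrow> adjacent u v"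
    by (auto simp: Aut_def tree_aut_def)
  have "inv_into UNIV f \<in> tree_aut"
    unfolding tree_aut_def
    using f by (auto simp: bij_imp_bij_inv bij_is_surj bij_is_inj inv_f_eq)
      (metis f(1) bij_inv_eq_iff f(3))+
  moreover have "inv_into UNIV f \<circ> f = id"
    using f(1) by (simp add: bij_is_inj)
  ultimately show "\<exists>g\<in>carrier Aut. g \<otimes>\<^bsub>Aut\<^esub> f = \<one>\<^bsub>Aut\<^esub>"
    by (auto simp: Aut_def)
qed (auto simp: Aut_def tree_aut_def o_assoc intro: bij_comp)

lemma fg_a_in_Aut: "fg_a \<in> carrier Aut"
proof -
  have inj: "fg_a u = fg_a v \<Longrightarrow> u = v" for u v
    by (cases u; cases v) auto
  have "\<exists>v. fg_a v = u" for u
  proof (cases u)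
    case (Cons x w)
    then have "fg_a ((x - 1) # w) = u" by simp
    then show ?thesis ..
  qed (auto intro: exI[of _ "[]"])
  then have "bij fg_a"
    using inj by (metis bijI injI surjI)
  moreover have len: "length (fg_a u) = length u" for u
    by (cases u) auto
  have app: "\<exists>y. fg_a (u @ [x]) = fg_a u @ [y]" for u x
    by (cases u) auto
  have "(\<exists>x. fg_a v = fg_a u @ [x]) \<longleftrightarrow> (\<exists>x. v = u @ [x])" for u v
  proof
    assume "\<exists>x. fg_a v = fg_a u @ [x]"
    then obtain x where x: "fg_a v = fg_a u @ [x]" ..
    then have "length v = Suc (length u)"
      by (metis len length_append_singleton)
    then obtain w y where v: "v = w @ [y]"
      by (metis length_Suc_conv_rev)
    then show "\<exists>x. v = u @ [x]"
      using x app[of w y] inj by auto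
  qed (use app in blast)
  ultimately show ?thesis
    by (simp add: Aut_def tree_aut_def adjacent_def)
qed

lemma fg_t_in_Aut: "fg_t \<in> carrier Aut"
proof -
  have a: "bij fg_a" "fg_a [] = []"
    using fg_a_in_Aut by (auto simp: Aut_def tree_aut_def)
  have inj: "fg_t u = fg_t v \<Longrightarrow> u = v" for u v
  proof (induction u arbitrary: v)
    case Nil
    then show ?case by (cases v) auto
  next
    case (Cons x u)
    then show ?case
      using a(1) by (cases v) (auto split: if_splits dest: bij_is_inj injD)
  qed
  have "\<exists>v. fg_t v = u" for u
  proof (induction u)
    case Nil
    show ?case by (auto intro: exI[of _ "[]"])
  next
    case (Cons x w)
    then obtain v where v: "fg_t v = w" ..
    obtain v' where v': "fg_a v' = w"
      using a(1) by (metis bij_pointE)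
    have "fg_t (x # (if x = 0 then v' else if x = 1 then w else v)) = x # w"
      using v v' by simp
    then show ?case ..
  qed
  then have "bij fg_t"
    using inj by (metis bijI injI surjI)
  moreover have lena: "length (fg_a u) = length u" for u
    by (cases u) auto
  have len: "length (fg_t u) = length u" for u
    by (induction u) (auto simp: lena)
  have appa: "\<exists>y. fg_a (u @ [x]) = fg_a u @ [y]" for u x
    by (cases u) auto
  have app: "\<exists>y. fg_t (u @ [x]) = fg_t u @ [y]" for u x
    using appa by (induction u) auto
  have "(\<exists>x. fg_t v = fg_t u @ [x]) \<longleftrightarrow> (\<exists>x. v = u @ [x])" for u v
  proof
    assume "\<exists>x. fg_t v = fg_t u @ [x]"
    then obtain x where x: "fg_t v = fg_t u @ [x]" ..
    then have "length v = Suc (length u)"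
      by (metis len length_append_singleton)
    then obtain w y where v: "v = w @ [y]"
      by (metis length_Suc_conv_rev)
    then show "\<exists>x. v = u @ [x]"
      using x app[of w y] inj by auto
  qed (use app in blast)
  ultimately show ?thesis
    by (simp add: Aut_def tree_aut_def adjacent_def)
qed

lemma carrier_Fabrykowski_Gupta:
  "carrier Fabrykowski_Gupta = generate Aut {fg_a, fg_t}"
  using fg_a_in_Aut fg_t_in_Aut
  by (simp add: Fabrykowski_Gupta_def carrier_subgroup_generated Int_absorb1)

end

theory Submission
  imports Defs "HOL-Real_Asymp.Real_Asymp"
begin

text \<open>
  Every element of the group is a product \<open>a\<^sup>c t\<^sup>\<plusminus>\<^sup>1 a\<^sup>s t\<^sup>\<plusminus>\<^sup>1 a\<^sup>s \<dots>\<close>, and up to constant factors its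
  word length is the least number of letters \<open>t\<^sup>\<plusminus>\<^sup>1\<close> in such a product. This number is called
  the length below.

  \<^bold>\<open>Upper bound.\<close> A letter \<open>t\<^sup>\<plusminus>\<^sup>1\<close> contributes one \<open>t\<^sup>\<plusminus>\<^sup>1\<close> and one \<open>a\<^sup>\<plusminus>\<^sup>1\<close> to the three sections of
  the element on the subtrees below the root. Hence passing to sections never increases the total
  length, and it decreases it whenever two letters \<open>t\<^sup>\<plusminus>\<^sup>1\<close> become adjacent in a section and merge.
  Every switch of the rotation exponents \<open>s\<close> from \<open>2\<close> to \<open>1\<close> (reading a word from right to left)
  leads to such a loss, so the exponents \<open>s\<close> of a word that barely shrinks are almost constant. In such
  a word each section reads \<open>t\<^sup>\<plusminus>\<^sup>1 a\<^sup>\<plusminus>\<^sup>1 t\<^sup>\<plusminus>\<^sup>1 a\<^sup>\<plusminus>\<^sup>1 \<dots>\<close>, where now the exponents of \<open>a\<close> come from the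
  exponents of \<open>t\<close> in the original word; if the sections barely shrink either, these are almost
  constant too, and the whole word can be predicted up to a few errors. A potential function makes
  this quantitative (\<open>level2_contraction\<close>): the number of mispredicted letters is at most
  \<open>8\<close> times the total length lost on the second level, up to a constant.

  Therefore an element of length \<open>n\<close> either is given by one of the \<open>exp (O (\<epsilon> ln (1/\<epsilon>) n))\<close> words
  with \<open>O (\<epsilon> n)\<close> mispredictions, or is determined by nine sections of total length at most
  \<open>(1 - \<epsilon>) n\<close> (\<open>card_nf_ball_recursion\<close>). Iterating \<open>k\<close> times gives
  \<open>exp (O (\<epsilon> ln (1/\<epsilon>) + (1 - \<epsilon>)\<^sup>k) n)\<close> times the number of ways to distribute the length over the
  tree of sections. With \<open>k\<close> a small multiple of \<open>ln n\<close> the latter factor is negligible, and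
  \<open>\<epsilon>\<close> a multiple of \<open>ln (ln n) / ln n\<close> yields the upper bound.

  \<^bold>\<open>Lower bound.\<close> The substitution \<open>a \<mapsto> t\<close>, \<open>t \<mapsto> a t a\<^sup>-\<^sup>1\<close> at most doubles the length, up to an
  additive constant. It turns a word \<open>g\<close> whose exponent sums of \<open>a\<close> and of \<open>t\<close> both vanish modulo
  \<open>3\<close> into the element that acts as \<open>g\<close> on the first subtree and trivially on the two others. Conjugating by
  \<open>a\<close>, one combines any three such words of length at most \<open>n\<close> into one of length at most
  \<open>6 n + 3\<close> (\<open>card_balanced_ball_cube\<close>). So multiplying the length by about \<open>6\<close> cubes the number
  of elements, which explains the exponent \<open>ln 3 / ln 6\<close>.
\<close>

section \<open>Letters and generators\<close>

lemma three_cases: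
  obtains "x = 0" | "x = 1" | "x = (2::3)"
proof (cases x rule: bit1_cases)
  fix z :: int
  assume z: "x = of_int z" "0 \<le> z" "z < int CARD(1 bit1)"
  then have "z = 0 \<or> z = 1 \<or> z = 2" by auto
  then show ?thesis using z that by auto
qed

lemma UNIV_three: "(UNIV :: 3 set) = {0, 1, 2}"
  using three_cases by blast

lemma minus_mod_three [simp]: "- (1::3) = 2" "- (2::3) = 1" "(1::3) - 2 = 2"
  by simp_all

definition rot :: "3 \<Rightarrow> vertex \<Rightarrow> vertex" where
  "rot c w = (case w of [] \<Rightarrow> [] | x # u \<Rightarrow> (x + c) # u)"

definition expo :: "bool \<Rightarrow> 3" where
  "expo e = (if e then 1 else 2)"

text \<open>The directed generator and its inverse; a truth value encodes the sign, so that an exponent of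
  \<open>t\<close> is nonzero by its type.\<close>

definition dir :: "bool \<Rightarrow> vertex \<Rightarrow> vertex" where
  "dir e = (if e then fg_t else fg_t \<circ> fg_t)"

lemma rot_simps [simp]: "rot c [] = []" "rot c (x # u) = (x + c) # u"
  by (simp_all add: rot_def)

lemma rot_0 [simp]: "rot 0 = id"
  by (rule ext) (simp add: rot_def split: list.split)

lemma rot_rot: "rot c \<circ> rot d = rot (c + d)"
  by (rule ext) (simp add: rot_def add.assoc add.commute split: list.split)

lemma rot_1: "rot 1 = fg_a"
proof
  show "rot 1 w = fg_a w" for w by (cases w) auto
qed

lemma rot_2: "rot 2 = fg_a \<circ> fg_a"
  by (simp flip: rot_1 add: rot_rot)

lemma dir_simps [simp]:
  "dir e [] = []"
  "dir e (x # u) = x # (if x = 0 then rot (expo e) u else if x = 1 then u else dir e u)"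
  by (auto simp: dir_def expo_def rot_1 rot_2)

lemma fg_t_cube: "fg_t (fg_t (fg_t w)) = w"
proof (induction w)
  case (Cons x w)
  have "fg_a (fg_a (fg_a w)) = w"
    by (cases w) auto
  with Cons show ?case by auto
qed auto

lemma dir_dir_same: "dir e \<circ> dir e = dir (\<not> e)"
  by (rule ext) (auto simp: dir_def fg_t_cube)

lemma dir_dir_opposite: "e \<noteq> e' \<Longrightarrow> dir e \<circ> dir e' = id"
  by (rule ext) (auto simp: dir_def fg_t_cube)

section \<open>Normal forms and sections\<close>

type_synonym syllables = "(bool \<times> 3) list"

text \<open>The pair \<open>(c, V)\<close> stands for \<open>a\<^sup>c\<close> followed by the syllables \<open>t\<^sup>\<plusminus>\<^sup>1 a\<^sup>s\<close> of \<open>V\<close>. Nothing prevents an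
  interior \<open>s\<close> from vanishing; only the reductions made by \<open>push_dir\<close> matter below.\<close>

type_synonym nf = "3 \<times> syllables"

primrec ev_syl :: "syllables \<Rightarrow> vertex \<Rightarrow> vertex" where
  "ev_syl [] = id"
| "ev_syl (b # V) = dir (fst b) \<circ> rot (snd b) \<circ> ev_syl V"

definition ev :: "nf \<Rightarrow> vertex \<Rightarrow> vertex" where
  "ev v = rot (fst v) \<circ> ev_syl (snd v)"

text \<open>Left multiplication by a generator. In \<open>push_dir\<close>, a letter \<open>t\<^sup>\<plusminus>\<^sup>1\<close> that meets another one directly
  merges with it: equal signs give \<open>t\<^sup>2 = t\<^sup>-\<^sup>1\<close>, opposite signs cancel. These are the places where
  length is lost.\<close>

definition push_rot :: "3 \<Rightarrow> nf \<Rightarrow> nf" where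
  "push_rot d v = (d + fst v, snd v)"

definition push_dir :: "bool \<Rightarrow> nf \<Rightarrow> nf" where
  "push_dir e v = (case snd v of
      [] \<Rightarrow> (0, [(e, fst v)])
    | b # V \<Rightarrow>
        if fst v \<noteq> 0 then (0, (e, fst v) # b # V)
        else if e = fst b then (0, (\<not> e, snd b) # V)
        else (snd b, V))"

lemma ev_push_rot [simp]: "ev (push_rot d v) = rot d \<circ> ev v"
  by (simp add: ev_def push_rot_def o_assoc rot_rot)

lemma ev_push_dir [simp]: "ev (push_dir e v) = dir e \<circ> ev v"
proof (cases "snd v")
  case (Cons b V)
  then show ?thesis
    by (auto simp: ev_def push_dir_def o_assoc dir_dir_same dir_dir_opposite)
qed (simp add: ev_def push_dir_def)

lemma length_push_rot [simp]: "length (snd (push_rot d v)) = length (snd v)"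
  by (simp add: push_rot_def)

lemma length_push_dir: "length (snd (push_dir e v)) \<le> Suc (length (snd v))"
  by (simp add: push_dir_def split: list.split)

text \<open>The action on the first level is the rotation by the exponent sum of \<open>a\<close>, because \<open>t\<close> fixes the
  first level.\<close>

primrec turn :: "syllables \<Rightarrow> 3" where
  "turn [] = 0"
| "turn (b # W) = snd b + turn W"

text \<open>Sections are indexed by the image letter rather than by the source letter. In this indexing, a
  syllable \<open>t\<^sup>e a\<^sup>s\<close> multiplied from the left first shifts the three sections by \<open>s\<close> and then
  multiplies the section at \<open>0\<close> by \<open>a\<^sup>e\<close> and the one at \<open>2\<close> by \<open>t\<^sup>e\<close>, which is the recursion
  \<open>t = \<langle>\<langle>a, 1, t\<rangle>\<rangle>\<close>.\<close>

primrec sec :: "syllables \<Rightarrow> 3 \<Rightarrow> nf" where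
  "sec [] = (\<lambda>_. (0, []))"
| "sec (b # W) = (\<lambda>y. sec W (y - snd b))
     (0 := push_rot (expo (fst b)) (sec W (0 - snd b)), 2 := push_dir (fst b) (sec W (2 - snd b)))"

lemma ev_syl_Cons:
  "ev_syl W (x # u) = (x + turn W) # ev (sec W (x + turn W)) u"
proof (induction W)
  case Nil
  then show ?case by (simp add: ev_def)
next
  case (Cons b W)
  have assoc: "x + turn W + snd b = x + (snd b + turn W)"
    by (simp add: algebra_simps)
  have shift: "x + turn W = y - snd b" if "x + (snd b + turn W) = y" for y
    using that by (simp add: algebra_simps)
  show ?case
    using three_cases[of "x + (snd b + turn W)"]
    by cases (auto simp: Cons.IH assoc shift)
qed

lemma ev_syl_Nil [simp]: "ev_syl W [] = []"
  by (induction W) auto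

lemma ev_Nil [simp]: "ev v [] = []"
  by (simp add: ev_def)

lemma ev_Cons:
  "ev v (x # u) = (x + (turn (snd v) + fst v)) # ev (sec (snd v) (x + turn (snd v))) u"
  by (simp add: ev_def ev_syl_Cons add.assoc)

section \<open>Words that barely shrink are predictable\<close>

text \<open>Words grow at the left end, so the head of the list is the most recent syllable. The default
  \<open>1\<close> acts as a virtual exponent to the right of the word.\<close>

definition last_step :: "syllables \<Rightarrow> 3" where
  "last_step V = (case V of [] \<Rightarrow> 1 | b # _ \<Rightarrow> snd b)"

lemma last_step_simps [simp]: "last_step [] = 1" "last_step (b # V) = snd b"
  by (simp_all add: last_step_def)

text \<open>Only the distinction between \<open>2\<close> and the other exponents is recorded; this treats the exponent
  \<open>0\<close>, which can occur in a syllable, like \<open>1\<close>.\<close>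

primrec changes :: "syllables \<Rightarrow> nat" where
  "changes [] = 0"
| "changes (b # V) = changes V + of_bool ((snd b = 2) \<noteq> (last_step V = 2))"

text \<open>A nonzero exponent \<open>c\<close> in front of \<open>(c, V)\<close> is going to be an exponent between two letters
  \<open>t\<^sup>\<plusminus>\<^sup>1\<close> once the next \<open>t\<^sup>\<plusminus>\<^sup>1\<close> is pushed. Its change is counted in advance, so that the change is
  charged to the letter that causes it, and pushing this \<open>t\<^sup>\<plusminus>\<^sup>1\<close> does not alter the count.\<close>

definition pending_changes :: "nf \<Rightarrow> nat" where
  "pending_changes v = changes (snd v) + of_bool (fst v \<noteq> 0 \<and> (fst v = 2) \<noteq> (last_step (snd v) = 2))"

text \<open>A normal form is loose if the next letter \<open>t\<^sup>\<plusminus>\<^sup>1\<close> is not going to merge, so that its length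
  increases. Right after pushing \<open>t\<^sup>\<plusminus>\<^sup>1\<close>, this is only the case if that letter has cancelled.\<close>

definition loose :: "nf \<Rightarrow> bool" where
  "loose v \<longleftrightarrow> fst v \<noteq> 0 \<or> snd v = []"

definition weight :: "nat \<Rightarrow> nf \<Rightarrow> int" where
  "weight l v = 8 * int (length (snd v)) - int (l * pending_changes v)"

text \<open>The predicted \<open>s\<close> repeats the previous one. The predicted sign \<open>e\<close> is chosen so that the
  factor \<open>a\<^sup>e\<close>, which goes to the section shifted to position \<open>0\<close>, repeats the latest exponent of
  \<open>a\<close> in that section, with \<open>0\<close> treated like \<open>1\<close> again.\<close>

definition predict :: "syllables \<Rightarrow> bool \<times> 3" where
  "predict W = (let s = (if last_step W = 2 then 2 else 1)
     in (last_step (snd (sec W (0 - s))) \<noteq> 2, s))"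

text \<open>For \<open>l = 0\<close> the weights measure the length of the sections, for \<open>l = 1\<close> they also
  subtract the changes, which bounds what remains of the length on the second
  level. Two corrections make every single step satisfy an estimate. A section that has just received \<open>t\<^sup>\<plusminus>\<^sup>1\<close> (at position \<open>2\<close>, or at
  position \<open>1\<close> one step later if \<open>s = 2\<close>) is normally not loose; if it is, a cancellation has
  saved so much that \<open>4\<close> can be set aside for the next push. The summand \<open>2\<close> balances the
  two kinds of changes of \<open>s\<close>: from \<open>2\<close> to \<open>1\<close> a loss is forced unless that reserve is there, in the other
  direction nothing need be lost.\<close>

definition potential :: "nat \<Rightarrow> syllables \<Rightarrow> int" where
  "potential l W = weight l (sec W 0) + weight l (sec W 1) + weight l (sec W 2) + 4 * of_bool (loose (sec W 2))
     + (if last_step W = 2 then 4 * of_bool (loose (sec W 1)) else 2)"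

lemma weight_push_rot_le:
  assumes "l \<le> 1"
  shows "weight l (push_rot d v) \<le> weight l v + int l"
proof -
  have "l = 0 \<or> l = 1" using assms by auto
  then show ?thesis by (auto simp: weight_def push_rot_def pending_changes_def)
qed

text \<open>A section that is not loose carries no exponent of \<open>a\<close> in front, so a new factor \<open>a\<^sup>e\<close> shows at
  once whether it agrees with the latest exponent. Loose sections are paid for by the reserve
  \<open>4\<close>.\<close>

lemma weight_push_rot_expo_le:
  assumes "l \<le> 1"
  shows "weight l (push_rot (expo e) v)
    \<le> weight l v + 4 * of_bool (loose v) - int (l * of_bool (e = (last_step (snd v) = 2)))"
proof (cases "loose v")
  case True
  then show ?thesis
    using weight_push_rot_le[OF assms, of "expo e" v] assms by auto
next
  case False
  have "l = 0 \<or> l = 1" using assms by auto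
  then show ?thesis
    using False by (auto simp: weight_def push_rot_def pending_changes_def loose_def expo_def)
qed

text \<open>Pushing \<open>t\<^sup>\<plusminus>\<^sup>1\<close> onto a loose section costs a full letter, and the result is not loose. Otherwise
  the letter merges for free, or cancels and gains \<open>8\<close>, or \<open>7\<close> when a change of exponents
  disappears; this pays for the reserve \<open>4\<close> of a possibly loose result.\<close>

lemma weight_push_dir_le:
  assumes "l \<le> 1"
  shows "weight l (push_dir e v) + 4 * of_bool (loose (push_dir e v))
    \<le> weight l v + 8 * of_bool (loose v)"
proof (cases "snd v")
  case Nil
  then show ?thesis
    using assms by (auto simp: weight_def push_dir_def pending_changes_def loose_def)
next
  case (Cons b V)
  have "l = 0 \<or> l = 1" using assms by auto
  then show ?thesis
    using Cons by (auto simp: weight_def push_dir_def pending_changes_def loose_def)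
qed

text \<open>The amortised estimate: a letter costs at most \<open>8\<close>, and a letter that changes \<open>s\<close> to or from \<open>2\<close>,
  or for \<open>l = 1\<close> one that differs from the prediction, at most \<open>7\<close>. The three values of \<open>s\<close> are treated
  separately because they bring different sections to the positions \<open>0\<close> and \<open>2\<close>. The exponent
  \<open>s = 0\<close> lets two consecutive letters meet in the same section and is cheap.\<close>

lemma potential_step:
  assumes l: "l \<le> 1"
  shows "potential l (b # W) \<le> potential l W + 8 -
    (if (snd b = 2) \<noteq> (last_step W = 2) then 1 else of_bool (l = 1 \<and> b \<noteq> predict W))"
proof -
  obtain e s where b: "b = (e, s)" by (cases b)
  define X where "X = sec W"
  note R = weight_push_rot_le[OF l] and E = weight_push_rot_expo_le[OF l] and D = weight_push_dir_le[OF l]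
  have l': "l = 0 \<or> l = 1" using l by auto
  show ?thesis
    using three_cases[of s]
  proof cases
    case 1
    show ?thesis
      using R[of "expo e" "X 0"] D[of e "X 2"] l
      by (auto simp: potential_def b 1 predict_def Let_def simp flip: X_def split: if_splits)
  next
    case 2
    show ?thesis
      using E[of e "X 2"] D[of e "X 1"] l'
      by (auto simp: potential_def b 2 predict_def Let_def simp flip: X_def split: if_splits)
  next
    case 3
    have "weight l (push_dir e (X 0)) + 4 * of_bool (loose (push_dir e (X 0))) \<le> weight l (X 0) + 8"
      using D[of e "X 0"] by (cases "loose (X 0)") auto
    then show ?thesis
      using E[of e "X 1"] R[of "expo e" "X 1"] l'
      by (auto simp: potential_def b 3 predict_def Let_def simp flip: X_def split: if_splits)
  qed
qed

primrec deviations :: "('a list \<Rightarrow> 'a) \<Rightarrow> 'a list \<Rightarrow> nat" where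
  "deviations p [] = 0"
| "deviations p (b # W) = deviations p W + of_bool (b \<noteq> p W)"

lemma potential_0_le: "potential 0 W \<le> 8 * int (length W) + 6 - int (changes W)"
proof (induction W)
  case Nil
  show ?case by (simp add: potential_def weight_def loose_def)
next
  case (Cons b W)
  show ?case
    using Cons.IH potential_step[of 0 b W] by (auto split: if_splits)
qed

lemma potential_1_le: "potential 1 W \<le> 8 * int (length W) + 6 - int (deviations predict W)"
proof (induction W)
  case Nil
  show ?case by (simp add: potential_def weight_def loose_def pending_changes_def)
next
  case (Cons b W)
  show ?case
    using Cons.IH potential_step[of 1 b W] by (auto split: if_splits)
qed

lemma sum_weight_le_potential: "(\<Sum>y\<in>UNIV. weight l (sec W y)) \<le> potential l W"
  unfolding UNIV_three by (simp add: potential_def)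

definition level2_length :: "syllables \<Rightarrow> nat" where
  "level2_length W = (\<Sum>y\<in>UNIV. \<Sum>z\<in>UNIV. length (snd (sec (snd (sec W y)) z)))"

text \<open>Every change of \<open>s\<close> to or from \<open>2\<close> loses at least an eighth of a letter on the first
  level; \<open>6\<close> is the potential of the empty word.\<close>

lemma level1_contraction:
  "8 * (\<Sum>y\<in>UNIV. int (length (snd (sec W y)))) \<le> 8 * int (length W) + 6 - int (changes W)"
proof -
  have "weight 0 v = 8 * int (length (snd v))" for v
    by (simp add: weight_def)
  then show ?thesis
    using sum_weight_le_potential[of 0 W] potential_0_le[of W] unfolding sum_distrib_left by simp
qed

text \<open>The case \<open>l = 1\<close> of the potential bounds the lengths of the sections minus their changes, and by
  the case \<open>l = 0\<close>, applied to each section, this bounds the length on the second level. The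
  constant is \<open>27 = 6 + 3 * 7\<close>, where \<open>7\<close> accounts for the empty word and one pending change in
  each section.\<close>

lemma level2_contraction:
  "8 * int (level2_length W) + int (deviations predict W) \<le> 8 * int (length W) + 27"
proof -
  have "8 * int (level2_length W) = (\<Sum>y\<in>UNIV. 8 * (\<Sum>z\<in>UNIV. int (length (snd (sec (snd (sec W y)) z)))))"
    unfolding level2_length_def of_nat_sum by (simp only: sum_distrib_left)
  also have "\<dots> \<le> (\<Sum>y\<in>UNIV. weight 1 (sec W y) + 7)"
  proof (rule sum_mono)
    fix y
    show "8 * (\<Sum>z\<in>UNIV. int (length (snd (sec (snd (sec W y)) z)))) \<le> weight 1 (sec W y) + 7"
      using level1_contraction[of "snd (sec W y)"] by (auto simp: weight_def pending_changes_def)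
  qed
  also have "\<dots> = (\<Sum>y\<in>UNIV. weight 1 (sec W y)) + 21"
    by (simp add: sum.distrib)
  also have "\<dots> \<le> potential 1 W + 21"
    using sum_weight_le_potential[of 1 W] by simp
  finally show ?thesis
    using potential_1_le[of W] by simp
qed

section \<open>Counting words with few mispredictions\<close>

text \<open>Whatever the rule \<open>p\<close>, exactly one of the possible next letters is the predicted one, so the
  generating function of the number of deviations is that of independent trials.\<close>

lemma sum_power_deviations:
  fixes p :: "'a::finite list \<Rightarrow> 'a" and x :: real
  shows "(\<Sum>W | length W = n. x ^ deviations p W) = (1 + (real CARD('a) - 1) * x) ^ n"
proof (induction n)
  case 0
  have "{W::'a list. length W = 0} = {[]}" by auto
  then show ?case by simp
next
  case (Suc n)
  have eq: "{W::'a list. length W = Suc n} = (\<lambda>(b, W). b # W) ` (UNIV \<times> {W. length W = n})"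
    by (force simp: length_Suc_conv)
  have inj: "inj_on (\<lambda>(b, W). b # W) (UNIV \<times> {W::'a list. length W = n})"
    by (auto simp: inj_on_def)
  have card: "real (card (UNIV - {c::'a})) = real CARD('a) - 1" for c
  proof -
    have "CARD('a) = Suc (card (UNIV - {c}))"
      by (rule card.remove) auto
    then show ?thesis by (simp only: of_nat_Suc)
  qed
  have one: "(\<Sum>b\<in>UNIV. x ^ deviations p (b # W)) = (1 + (real CARD('a) - 1) * x) * x ^ deviations p W"
    for W
  proof -
    have "(\<Sum>b\<in>UNIV. x ^ deviations p (b # W))
        = x ^ deviations p (p W # W) + (\<Sum>b\<in>UNIV - {p W}. x ^ deviations p (b # W))"
      by (subst sum.remove[of _ "p W"]) auto
    also have "(\<Sum>b\<in>UNIV - {p W}. x ^ deviations p (b # W))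
        = (\<Sum>b\<in>UNIV - {p W}. x * x ^ deviations p W)"
      by (intro sum.cong) auto
    also have "\<dots> = (real CARD('a) - 1) * (x * x ^ deviations p W)"
      using card by simp
    finally show ?thesis by (simp add: algebra_simps)
  qed
  have "(\<Sum>W | length W = Suc n. x ^ deviations p W)
      = (\<Sum>W | length W = n. \<Sum>b\<in>UNIV. x ^ deviations p (b # W))"
    unfolding eq
    by (subst sum.reindex[OF inj], subst sum.swap, simp only: sum.cartesian_product)
      (auto simp: case_prod_beta intro!: sum.cong)
  also have "\<dots> = (1 + (real CARD('a) - 1) * x) * (\<Sum>W | length W = n. x ^ deviations p W)"
    by (simp only: one sum_distrib_left)
  finally show ?case by (simp add: Suc.IH)
qed

lemma finite_lists_of_length: "finite {W::'a::finite list. length W = n}"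
  using finite_lists_length_eq[of "UNIV::'a set" n] by simp

lemma finite_lists_upto: "finite {W::'a::finite list. length W \<le> n}"
  using finite_lists_length_le[of "UNIV::'a set" n] by simp

text \<open>A Chernoff bound: each word counted contributes at least \<open>x\<^sup>s\<close> to the generating function.\<close>

lemma card_few_deviations:
  fixes p :: "'a::finite list \<Rightarrow> 'a" and x :: real
  assumes x: "0 < x" "x \<le> 1"
  shows "real (card {W. length W \<le> n \<and> deviations p W \<le> s}) * x ^ s
    \<le> (real n + 1) * (1 + (real CARD('a) - 1) * x) ^ n"
proof -
  have C: "1 \<le> CARD('a)" by (simp add: Suc_leI)
  have fin: "finite {W. length W \<le> n \<and> deviations p W \<le> s}"
    by (rule finite_subset[OF _ finite_lists_upto[of n]]) auto
  have "real (card {W. length W \<le> n \<and> deviations p W \<le> s}) * x ^ s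
      = (\<Sum>W | length W \<le> n \<and> deviations p W \<le> s. x ^ s)"
    by simp
  also have "\<dots> \<le> (\<Sum>W | length W \<le> n \<and> deviations p W \<le> s. x ^ deviations p W)"
    using x by (intro sum_mono power_decreasing) auto
  also have "\<dots> \<le> (\<Sum>W | length W \<le> n. x ^ deviations p W)"
    using x by (intro sum_mono2 finite_lists_upto) auto
  also have "{W::'a list. length W \<le> n} = (\<Union>k\<le>n. {W. length W = k})"
    by auto
  also have "(\<Sum>W\<in>(\<Union>k\<le>n. {W. length W = k}). x ^ deviations p W)
      = (\<Sum>k\<le>n. \<Sum>W | length W = k. x ^ deviations p W)"
    by (intro sum.UNION_disjoint) (auto simp: finite_lists_of_length)
  also have "\<dots> = (\<Sum>k\<le>n. (1 + (real CARD('a) - 1) * x) ^ k)"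
    by (simp only: sum_power_deviations)
  also have "\<dots> \<le> (\<Sum>k\<le>n. (1 + (real CARD('a) - 1) * x) ^ n)"
    using x C by (intro sum_mono power_increasing) auto
  finally show ?thesis by (simp add: algebra_simps)
qed

section \<open>Recursion for the number of elements\<close>

definition nf_ball :: "nat \<Rightarrow> (vertex \<Rightarrow> vertex) set" where
  "nf_ball n = ev ` {v. length (snd v) \<le> n}"

text \<open>In contrast to \<open>sec\<close>, sections are indexed by the source letter here.\<close>

definition build :: "3 \<Rightarrow> (3 \<Rightarrow> vertex \<Rightarrow> vertex) \<Rightarrow> vertex \<Rightarrow> vertex" where
  "build r h w = (case w of [] \<Rightarrow> [] | x # u \<Rightarrow> (x + r) # h x u)"

lemma build_simps [simp]: "build r h [] = []" "build r h (x # u) = (x + r) # h x u"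
  by (simp_all add: build_def)

lemma ev_eq_build:
  "ev v = build (turn (snd v) + fst v) (\<lambda>x. ev (sec (snd v) (x + turn (snd v))))"
proof
  show "ev v w = build (turn (snd v) + fst v) (\<lambda>x. ev (sec (snd v) (x + turn (snd v)))) w" for w
    by (cases w) (simp_all add: ev_Cons)
qed

definition build2 :: "3 \<times> (3 \<Rightarrow> 3) \<times> (3 \<times> 3 \<Rightarrow> vertex \<Rightarrow> vertex) \<Rightarrow> vertex \<Rightarrow> vertex" where
  "build2 = (\<lambda>(r, q, h). build r (\<lambda>x. build (q x) (\<lambda>y. h (x, y))))"

text \<open>The possible lengths of the nine sections on the second level.\<close>

definition profiles :: "nat \<Rightarrow> (3 \<times> 3 \<Rightarrow> nat) set" where
  "profiles M = {l. sum l UNIV \<le> M}"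

lemma sum_rotate: "(\<Sum>x\<in>UNIV. f (x + c)) = (\<Sum>x\<in>(UNIV::3 set). (f x :: nat))"
proof (rule sum.reindex_bij_witness[of _ "\<lambda>x. x - c" "\<lambda>x. x + c"])
qed auto

text \<open>An element is determined by its action on the first two levels and its nine sections there.\<close>

lemma ev_in_build2:
  assumes "level2_length (snd v) \<le> M"
  shows "ev v \<in> build2 ` (UNIV \<times> UNIV \<times> (\<Union>l\<in>profiles M. PiE UNIV (\<lambda>i. nf_ball (l i))))"
proof -
  define s where "s x = sec (snd v) (x + turn (snd v))" for x
  define u where "u = (\<lambda>(x, y). sec (snd (s x)) (y + turn (snd (s x))))"
  have "ev v = build (turn (snd v) + fst v) (\<lambda>x. ev (s x))"
    unfolding s_def by (rule ev_eq_build)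
  also have "(\<lambda>x. ev (s x)) = (\<lambda>x. build (turn (snd (s x)) + fst (s x)) (\<lambda>y. ev (u (x, y))))"
    unfolding u_def by (rule ext) (simp add: ev_eq_build[symmetric])
  finally have eq: "ev v = build2 (turn (snd v) + fst v, \<lambda>x. turn (snd (s x)) + fst (s x), ev \<circ> u)"
    by (simp add: build2_def)
  have "(\<Sum>i\<in>UNIV. length (snd (u i))) = (\<Sum>x\<in>UNIV. \<Sum>y\<in>UNIV. length (snd (u (x, y))))"
    by (simp add: sum.cartesian_product)
  also have "\<dots> = (\<Sum>x\<in>UNIV. \<Sum>y\<in>UNIV. length (snd (sec (snd (s x)) y)))"
    unfolding u_def
    by (simp add: sum_rotate[of "\<lambda>y. length (snd (sec (snd (s _)) y))"])
  also have "\<dots> = level2_length (snd v)"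
    unfolding s_def level2_length_def
    by (rule sum_rotate[of "\<lambda>x. \<Sum>y\<in>UNIV. length (snd (sec (snd (sec (snd v) x)) y))"])
  finally have "(\<lambda>i. length (snd (u i))) \<in> profiles M"
    using assms by (simp add: profiles_def)
  moreover have "ev \<circ> u \<in> PiE UNIV (\<lambda>i. nf_ball (length (snd (u i))))"
    by (auto simp: nf_ball_def)
  ultimately show ?thesis
    unfolding eq by (intro imageI) blast
qed

lemma finite_nf_ball: "finite (nf_ball n)"
proof -
  have "{v::nf. length (snd v) \<le> n} = UNIV \<times> {W. length W \<le> n}" by auto
  then show ?thesis
    by (simp add: nf_ball_def finite_lists_upto)
qed

lemma card_nf_ball_le_exp: "real (card (nf_ball n)) \<le> 3 * (real n + 1) * 6 ^ n"
proof -
  have "{v::nf. length (snd v) \<le> n} = UNIV \<times> {W. length W \<le> n}" by auto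
  then have "card (nf_ball n) \<le> 3 * card {W::syllables. length W \<le> n}"
    unfolding nf_ball_def
    by (intro order.trans[OF card_image_le]) (auto simp: finite_lists_upto card_cartesian_product)
  \<comment> \<open>No word of length at most n has more than n deviations, so the previous bound applies with x = 1.\<close>
  moreover have "{W::syllables. length W \<le> n} = {W. length W \<le> n \<and> deviations predict W \<le> n}"
  proof -
    have "deviations predict W \<le> length W" for W by (induction W) auto
    then show ?thesis using order.trans by blast
  qed
  moreover have "real (card {W. length W \<le> n \<and> deviations predict W \<le> n}) \<le> (real n + 1) * 6 ^ n"
    using card_few_deviations[of 1 n predict n] by simp
  ultimately show ?thesis by (simp add: algebra_simps)
qed

lemma finite_profiles: "finite (profiles M)"
  and card_profiles_le: "real (card (profiles M)) \<le> (real M + 1) ^ 9"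
proof -
  have sub: "profiles M \<subseteq> PiE UNIV (\<lambda>_. {..M})"
  proof
    fix l assume "l \<in> profiles M"
    then have "l i \<le> M" for i
      using member_le_sum[of i UNIV l] by (auto simp: profiles_def)
    then show "l \<in> PiE UNIV (\<lambda>_. {..M})" by auto
  qed
  have fin: "finite (PiE (UNIV::(3\<times>3) set) (\<lambda>_. {..M}))"
    by (intro finite_PiE) auto
  show "finite (profiles M)" using finite_subset[OF sub fin] .
  have "card (profiles M) \<le> (M + 1) ^ 9"
    using card_mono[OF fin sub] by (simp add: card_PiE)
  then have "real (card (profiles M)) \<le> real ((M + 1) ^ 9)"
    by (simp only: of_nat_le_iff)
  then show "real (card (profiles M)) \<le> (real M + 1) ^ 9" by (simp add: algebra_simps)
qed

text \<open>Either a normal form has at most \<open>8 m + 27\<close> mispredicted letters, or it loses more than \<open>m\<close>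
  letters on the second level. The factors are \<open>3\<close> for the leading rotation and
  \<open>81 = 3 * 3\<^sup>3\<close> for the action on the first two levels.\<close>

lemma card_nf_ball_recursion:
  fixes x :: real
  assumes x: "0 < x" "x \<le> 1" and m: "m \<le> n"
  shows "real (card (nf_ball n)) \<le>
    3 * (real n + 1) * (1 + 5 * x) ^ n / x ^ (8 * m + 27)
    + 81 * (\<Sum>l\<in>profiles (n - m). \<Prod>i\<in>UNIV. real (card (nf_ball (l i))))"
proof -
  define low where "low = {W::syllables. length W \<le> n \<and> deviations predict W \<le> 8 * m + 27}"
  define R where "R = (\<Union>l\<in>profiles (n - m). PiE (UNIV::(3\<times>3) set) (\<lambda>i. nf_ball (l i)))"
  have finlow: "finite low"
    unfolding low_def by (rule finite_subset[OF _ finite_lists_upto[of n]]) auto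
  have finR: "finite R"
    unfolding R_def by (intro finite_UN_I finite_profiles finite_PiE finite_nf_ball) auto
  have "nf_ball n \<subseteq> ev ` (UNIV \<times> low) \<union> build2 ` (UNIV \<times> UNIV \<times> R)"
  proof
    fix g assume "g \<in> nf_ball n"
    then obtain v where v: "g = ev v" "length (snd v) \<le> n"
      by (auto simp: nf_ball_def)
    show "g \<in> ev ` (UNIV \<times> low) \<union> build2 ` (UNIV \<times> UNIV \<times> R)"
    proof (cases "snd v \<in> low")
      case True
      then have "v \<in> UNIV \<times> low" by (cases v) auto
      then show ?thesis using v by auto
    next
      case False
      then have "level2_length (snd v) \<le> n - m"
        using v level2_contraction[of "snd v"] by (auto simp: low_def)
      then show ?thesis
        using ev_in_build2[of v "n - m"] v by (auto simp: R_def)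
    qed
  qed
  then have "card (nf_ball n) \<le> card (ev ` (UNIV \<times> low) \<union> build2 ` (UNIV \<times> UNIV \<times> R))"
    by (intro card_mono) (auto simp: finlow finR)
  also have "\<dots> \<le> card (ev ` (UNIV \<times> low)) + card (build2 ` (UNIV \<times> UNIV \<times> R))"
    by (rule card_Un_le)
  also have "\<dots> \<le> card ((UNIV::3 set) \<times> low) + card ((UNIV::3 set) \<times> (UNIV::(3 \<Rightarrow> 3) set) \<times> R)"
    by (intro add_mono card_image_le) (auto simp: finlow finR)
  also have "\<dots> = 3 * card low + 81 * card R"
    by (simp add: card_cartesian_product card_fun)
  finally have "real (card (nf_ball n)) \<le> 3 * real (card low) + 81 * real (card R)"
    by linarith
  moreover have "real (card low) \<le> (real n + 1) * (1 + 5 * x) ^ n / x ^ (8 * m + 27)"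
    using card_few_deviations[OF x, of n predict "8 * m + 27"] x
    by (simp add: low_def field_simps)
  moreover have "real (card R) \<le> (\<Sum>l\<in>profiles (n - m). \<Prod>i\<in>UNIV. real (card (nf_ball (l i))))"
  proof -
    have "card R \<le> (\<Sum>l\<in>profiles (n - m). card (PiE (UNIV::(3\<times>3) set) (\<lambda>i. nf_ball (l i))))"
      unfolding R_def by (intro card_UN_le finite_profiles)
    also have "\<dots> = (\<Sum>l\<in>profiles (n - m). \<Prod>i\<in>UNIV. card (nf_ball (l i)))"
      by (simp add: card_PiE)
    finally have "real (card R) \<le> real (\<Sum>l\<in>profiles (n - m). \<Prod>i\<in>UNIV. card (nf_ball (l i)))"
      by (simp only: of_nat_le_iff)
    then show ?thesis by simp
  qed
  moreover have "3 * (real n + 1) * (1 + 5 * x) ^ n / x ^ (8 * m + 27)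
      = 3 * ((real n + 1) * (1 + 5 * x) ^ n / x ^ (8 * m + 27))"
    by simp
  ultimately show ?thesis by linarith
qed

section \<open>Growth in terms of normal forms\<close>

definition letters :: "(vertex \<Rightarrow> vertex) set" where
  "letters = {rot 1, rot 2, dir True, dir False}"

text \<open>The growth function counts this set. Its comparison with \<open>nf_ball\<close> rests on \<open>a\<^sup>2 = a\<^sup>-\<^sup>1\<close>: every
  power of \<open>a\<close> between two letters \<open>t\<^sup>\<plusminus>\<^sup>1\<close> is at most one generator.\<close>

definition products :: "nat \<Rightarrow> (vertex \<Rightarrow> vertex) set" where
  "products n = {foldr (\<circ>) ws id | ws. set ws \<subseteq> letters \<and> length ws \<le> n}"

lemma mult_Fabrykowski_Gupta: "mult Fabrykowski_Gupta = (\<circ>)" "one Fabrykowski_Gupta = id"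
  by (simp_all add: Fabrykowski_Gupta_def subgroup_generated_def Aut_def)

lemma inv_Fabrykowski_Gupta:
  shows "m_inv Fabrykowski_Gupta fg_a = rot 2" and "m_inv Fabrykowski_Gupta fg_t = dir False"
proof -
  interpret G: group Fabrykowski_Gupta
    unfolding Fabrykowski_Gupta_def by (rule group.group_subgroup_generated[OF group_Aut])
  have a: "fg_a \<in> carrier Fabrykowski_Gupta" and t: "fg_t \<in> carrier Fabrykowski_Gupta"
    unfolding carrier_Fabrykowski_Gupta by (auto intro: generate.incl)
  have "rot 2 \<in> carrier Fabrykowski_Gupta" "dir False \<in> carrier Fabrykowski_Gupta"
    using G.m_closed[OF a a] G.m_closed[OF t t] by (simp_all add: mult_Fabrykowski_Gupta rot_2 dir_def)
  moreover have "(2::3) + 1 = 0" by simp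
  then have "rot 2 \<circ> fg_a = id"
    using rot_rot[of 2 1] by (simp only: rot_1 rot_0)
  moreover have "dir False \<circ> fg_t = id"
    using dir_dir_opposite[of False True] by (simp add: dir_def)
  ultimately show "m_inv Fabrykowski_Gupta fg_a = rot 2" "m_inv Fabrykowski_Gupta fg_t = dir False"
    using G.inv_equality[OF _ a] G.inv_equality[OF _ t] by (simp_all add: mult_Fabrykowski_Gupta)
qed

lemma growth_eq_card_products: "growth Fabrykowski_Gupta {fg_a, fg_t} n = card (products n)"
proof -
  have "{fg_a, fg_t} \<union> m_inv Fabrykowski_Gupta ` {fg_a, fg_t} = letters"
    by (auto simp: letters_def inv_Fabrykowski_Gupta rot_1 dir_def)
  then show ?thesis
    by (simp add: growth_def products_def mult_Fabrykowski_Gupta)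
qed

lemma products_subset_nf_ball: "products n \<subseteq> nf_ball n"
proof -
  have "\<exists>v. foldr (\<circ>) ws id = ev v \<and> length (snd v) \<le> length ws" if "set ws \<subseteq> letters" for ws
    using that
  proof (induction ws)
    case Nil
    have "id = ev (0, [])" by (simp add: ev_def)
    then show ?case by (intro exI[of _ "(0, [])"]) simp
  next
    case (Cons g ws)
    then obtain v where v: "foldr (\<circ>) ws id = ev v" "length (snd v) \<le> length ws"
      by (metis insert_subset list.simps(15))
    from Cons.prems consider c where "g = rot c" | e where "g = dir e"
      by (auto simp: letters_def)
    then show ?case
    proof cases
      case 1
      have "foldr (\<circ>) (g # ws) id = ev (push_rot c v)"
        unfolding foldr_Cons o_apply v(1) 1 ev_push_rot ..
      moreover have "length (snd (push_rot c v)) \<le> length (g # ws)"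
        using v(2) by simp
      ultimately show ?thesis by blast
    next
      case 2
      have "foldr (\<circ>) (g # ws) id = ev (push_dir e v)"
        unfolding foldr_Cons o_apply v(1) 2 ev_push_dir ..
      moreover have "length (snd (push_dir e v)) \<le> length (g # ws)"
        using v(2) length_push_dir[of e v] by simp
      ultimately show ?thesis by blast
    qed
  qed
  then show ?thesis
    unfolding products_def nf_ball_def by fastforce
qed

lemma id_in_products: "id \<in> products n"
  unfolding products_def by (rule CollectI, rule exI[of _ "[]"]) simp

lemma products_Suc: "g \<in> letters \<Longrightarrow> f \<in> products n \<Longrightarrow> g \<circ> f \<in> products (Suc n)"
proof -
  assume g: "g \<in> letters" and "f \<in> products n"
  then obtain ws where "f = foldr (\<circ>) ws id" "set ws \<subseteq> letters" "length ws \<le> n"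
    by (auto simp: products_def)
  then show ?thesis
    using g unfolding products_def by (intro CollectI exI[of _ "g # ws"]) simp
qed

lemma products_mono: "m \<le> n \<Longrightarrow> products m \<subseteq> products n"
  unfolding products_def by fastforce

lemma rot_products: "f \<in> products n \<Longrightarrow> rot c \<circ> f \<in> products (Suc n)"
proof (cases c rule: three_cases)
  case 1
  moreover assume "f \<in> products n"
  ultimately show ?thesis using products_mono[of n "Suc n"] by auto
qed (auto intro!: products_Suc simp: letters_def)

lemma dir_products: "f \<in> products n \<Longrightarrow> dir e \<circ> f \<in> products (Suc n)"
  by (cases e) (auto intro!: products_Suc simp: letters_def)

lemma nf_ball_subset_products: "nf_ball n \<subseteq> products (2 * n + 1)"
proof -
  have syl: "ev_syl W \<in> products (2 * length W)" for W
  proof (induction W)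
    case (Cons b W)
    have "dir (fst b) \<circ> (rot (snd b) \<circ> ev_syl W) \<in> products (2 * length (b # W))"
      using dir_products[OF rot_products[OF Cons.IH], of "fst b" "snd b"] by simp
    then show ?case by (simp only: ev_syl.simps o_assoc)
  next
    case Nil
    show ?case unfolding ev_syl.simps by (rule id_in_products)
  qed
  have "ev v \<in> products (2 * n + 1)" if "length (snd v) \<le> n" for v
    using rot_products[OF syl, of "fst v" "snd v"] products_mono[of "2 * length (snd v) + 1" "2 * n + 1"] that
    by (auto simp: ev_def)
  then show ?thesis by (auto simp: nf_ball_def)
qed

section \<open>Cubing the number of elements\<close>

text \<open>The exponent sums modulo \<open>3\<close> of \<open>a\<close> and \<open>t\<close> are the same for a normal form before and after
  the reductions of \<open>push_dir\<close>, so they can be computed along any product.\<close>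

definition deg_a :: "nf \<Rightarrow> 3" where
  "deg_a v = fst v + turn (snd v)"

primrec twist :: "syllables \<Rightarrow> 3" where
  "twist [] = 0"
| "twist (b # W) = expo (fst b) + twist W"

definition deg_t :: "nf \<Rightarrow> 3" where
  "deg_t v = twist (snd v)"

definition dirpow :: "3 \<Rightarrow> vertex \<Rightarrow> vertex" where
  "dirpow s = (if s = 0 then id else dir (s = 1))"

text \<open>For \<open>s \<noteq> 0\<close> the exponent \<open>s\<close> of \<open>t\<close> is \<open>1\<close> or \<open>-1\<close>, hence a single letter.\<close>

definition push_pow :: "3 \<Rightarrow> nf \<Rightarrow> nf" where
  "push_pow s v = (if s = 0 then v else push_dir (s = 1) v)"

lemma deg_push_rot [simp]: "deg_a (push_rot d v) = d + deg_a v" "deg_t (push_rot d v) = deg_t v"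
  by (simp_all add: deg_a_def deg_t_def push_rot_def add.assoc)

lemma deg_push_dir [simp]: "deg_a (push_dir e v) = deg_a v" "deg_t (push_dir e v) = expo e + deg_t v"
proof -
  show "deg_a (push_dir e v) = deg_a v"
    by (auto simp: deg_a_def push_dir_def split: list.split)
  show "deg_t (push_dir e v) = expo e + deg_t v"
    by (cases "snd v")
      (auto simp: deg_t_def push_dir_def expo_def algebra_simps)
qed

lemma deg_push_pow [simp]: "deg_a (push_pow s v) = deg_a v" "deg_t (push_pow s v) = s + deg_t v"
  by (cases s rule: three_cases; simp add: push_pow_def expo_def)+

lemma ev_push_pow [simp]: "ev (push_pow s v) = dirpow s \<circ> ev v"
  by (simp add: push_pow_def dirpow_def)

lemma length_push_pow: "length (snd (push_pow s v)) \<le> Suc (length (snd v))"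
  using length_push_dir[of "s = 1" v] by (simp add: push_pow_def)

lemma dirpow_add: "dirpow s \<circ> dirpow s' = dirpow (s + s')"
proof -
  have "dir True \<circ> dir True = dir False" "dir False \<circ> dir False = dir True"
    "dir True \<circ> dir False = id" "dir False \<circ> dir True = id"
    by (simp_all add: dir_dir_same dir_dir_opposite)
  then show ?thesis
    by (cases s rule: three_cases; cases s' rule: three_cases; simp add: dirpow_def)
qed

text \<open>The automorphism \<open>\<langle>\<langle>f, g, h\<rangle>\<rangle>\<close> of the tree.\<close>

definition spread ::
  "(vertex \<Rightarrow> vertex) \<Rightarrow> (vertex \<Rightarrow> vertex) \<Rightarrow> (vertex \<Rightarrow> vertex) \<Rightarrow> vertex \<Rightarrow> vertex" where
  "spread f g h w = (case w of [] \<Rightarrow> []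
     | x # u \<Rightarrow> x # (if x = 0 then f u else if x = 1 then g u else h u))"

lemma spread_simps [simp]:
  "spread f g h [] = []"
  "spread f g h (x # u) = x # (if x = 0 then f u else if x = 1 then g u else h u)"
  by (simp_all add: spread_def)

lemma spread_comp: "spread f g h \<circ> spread f' g' h' = spread (f \<circ> f') (g \<circ> g') (h \<circ> h')"
  by (rule ext) (simp add: spread_def split: list.split)

lemma dirpow_eq_spread: "dirpow s = spread (rot s) id (dirpow s)"
proof
  show "dirpow s w = spread (rot s) id (dirpow s) w" for w
    by (cases w; cases s rule: three_cases) (simp_all add: dirpow_def expo_def)
qed

lemma conj_dir_eq_spread: "rot 1 \<circ> dir e \<circ> rot 2 = spread (dir e) (rot (expo e)) id"
proof
  show "(rot 1 \<circ> dir e \<circ> rot 2) w = spread (dir e) (rot (expo e)) id w" for w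
  proof (cases w)
    case (Cons x u)
    then show ?thesis by (cases x rule: three_cases) simp_all
  qed simp
qed

text \<open>The substitution \<open>a \<mapsto> t\<close>, \<open>t \<mapsto> a t a\<^sup>-\<^sup>1\<close>, with the result multiplied onto \<open>u\<close>. Since
  \<open>t = \<langle>\<langle>a, 1, t\<rangle>\<rangle>\<close> and \<open>a t a\<^sup>-\<^sup>1 = \<langle>\<langle>t, a, 1\<rangle>\<rangle>\<close>, a word reappears unchanged in the first coordinate,
  while the two other coordinates see only its exponent sums.\<close>

primrec lift_syl :: "syllables \<Rightarrow> nf \<Rightarrow> nf" where
  "lift_syl [] u = u"
| "lift_syl (b # W) u =
     push_rot 1 (push_dir (fst b) (push_rot 2 (push_pow (snd b) (lift_syl W u))))"

definition lift :: "nf \<Rightarrow> nf \<Rightarrow> nf" where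
  "lift v u = push_pow (fst v) (lift_syl (snd v) u)"

lemma ev_lift_syl:
  "ev (lift_syl W u) = spread (ev_syl W) (rot (twist W)) (dirpow (turn W)) \<circ> ev u"
proof (induction W)
  case Nil
  have "spread id id id = id"
    by (rule ext) (simp add: spread_def split: list.split)
  then show ?case
    by (simp only: lift_syl.simps ev_syl.simps twist.simps turn.simps rot_0 dirpow_def if_True refl id_o)
next
  case (Cons b W)
  have "ev (lift_syl (b # W) u)
      = (rot 1 \<circ> dir (fst b) \<circ> rot 2) \<circ> dirpow (snd b) \<circ> ev (lift_syl W u)"
    by (simp only: lift_syl.simps ev_push_rot ev_push_dir ev_push_pow o_assoc)
  also have "\<dots> = spread (dir (fst b)) (rot (expo (fst b))) id
      \<circ> spread (rot (snd b)) id (dirpow (snd b))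
      \<circ> (spread (ev_syl W) (rot (twist W)) (dirpow (turn W)) \<circ> ev u)"
    by (simp only: conj_dir_eq_spread Cons.IH flip: dirpow_eq_spread)
  also have "\<dots> = spread (ev_syl (b # W)) (rot (twist (b # W))) (dirpow (turn (b # W))) \<circ> ev u"
    by (simp only: o_assoc spread_comp rot_rot dirpow_add id_o o_id ev_syl.simps twist.simps turn.simps)
  finally show ?case .
qed

lemma ev_lift:
  "ev (lift v u) = spread (ev v) (rot (deg_t v)) (dirpow (deg_a v)) \<circ> ev u"
proof -
  have "ev (lift v u) = spread (rot (fst v)) id (dirpow (fst v)) \<circ> ev (lift_syl (snd v) u)"
    by (simp only: lift_def ev_push_pow flip: dirpow_eq_spread)
  also have "\<dots> = spread (rot (fst v) \<circ> ev_syl (snd v)) (rot (deg_t v)) (dirpow (deg_a v)) \<circ> ev u"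
    by (simp only: ev_lift_syl o_assoc spread_comp dirpow_add id_o deg_a_def deg_t_def)
  finally show ?thesis
    by (simp only: ev_def[of v])
qed

lemma deg_lift: "deg_a (lift v u) = deg_a u" "deg_t (lift v u) = deg_a v + deg_t v + deg_t u"
proof -
  have three: "1 + (2 + x) = x" for x :: 3
    by (simp add: add.assoc[symmetric])
  have "deg_a (lift_syl W u) = deg_a u \<and> deg_t (lift_syl W u) = turn W + twist W + deg_t u" for W
    by (induction W) (simp_all add: three algebra_simps)
  then show "deg_a (lift v u) = deg_a u" "deg_t (lift v u) = deg_a v + deg_t v + deg_t u"
    by (simp_all add: lift_def deg_a_def[of v] deg_t_def[of v] algebra_simps)
qed

text \<open>Each syllable \<open>t\<^sup>e a\<^sup>s\<close> turns into at most two letters \<open>t\<^sup>\<plusminus>\<^sup>1\<close>, one for \<open>t\<^sup>e\<close> and one for \<open>a\<^sup>s\<close>;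
  the leading power of \<open>a\<close> adds one more.\<close>

lemma length_lift: "length (snd (lift v u)) \<le> 2 * length (snd v) + 1 + length (snd u)"
proof -
  have "length (snd (lift_syl W u)) \<le> 2 * length W + length (snd u)" for W
  proof (induction W)
    case (Cons b W)
    then show ?case
      using length_push_dir[of "fst b" "push_rot 2 (push_pow (snd b) (lift_syl W u))"]
        length_push_pow[of "snd b" "lift_syl W u"] by simp
  qed simp
  from this[of "snd v"] show ?thesis
    using length_push_pow[of "fst v" "lift_syl (snd v) u"] by (simp add: lift_def)
qed

definition balanced_ball :: "nat \<Rightarrow> (vertex \<Rightarrow> vertex) set" where
  "balanced_ball n = ev ` {v. length (snd v) \<le> n \<and> deg_a v = 0 \<and> deg_t v = 0}"

lemma balanced_ball_subset: "balanced_ball n \<subseteq> nf_ball n"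
  by (auto simp: balanced_ball_def nf_ball_def)

lemma balanced_ball_mono: "m \<le> n \<Longrightarrow> balanced_ball m \<subseteq> balanced_ball n"
  by (fastforce simp: balanced_ball_def)

lemma spread_in_balanced_ball:
  assumes "f \<in> balanced_ball n" "g \<in> balanced_ball n" "h \<in> balanced_ball n"
  shows "spread f g h \<in> balanced_ball (6 * n + 3)"
proof -
  obtain u v w where uvw: "f = ev u" "g = ev v" "h = ev w"
    and len: "length (snd u) \<le> n" "length (snd v) \<le> n" "length (snd w) \<le> n"
    and deg: "deg_a u = 0" "deg_t u = 0" "deg_a v = 0" "deg_t v = 0" "deg_a w = 0" "deg_t w = 0"
    using assms by (auto simp: balanced_ball_def)
  \<comment> \<open>The three lifts are moved to the three coordinates by conjugation with powers of a, and a^3 = 1.\<close>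
  define z where "z = lift u (push_rot 1 (lift v (push_rot 1 (lift w (push_rot 1 (0, []))))))"
  have "deg_a z = 0" "deg_t z = 0"
    by (simp_all add: z_def deg_lift deg) (simp_all add: deg_a_def deg_t_def)
  moreover have "length (snd z) \<le> 6 * n + 3"
    using len length_lift[of u "push_rot 1 (lift v (push_rot 1 (lift w (push_rot 1 (0, [])))))"]
      length_lift[of v "push_rot 1 (lift w (push_rot 1 (0, [])))"]
      length_lift[of w "push_rot 1 (0, [])"]
    by (simp add: z_def)
  moreover have "ev z = spread f g h"
  proof
    fix p
    show "ev z p = spread f g h p"
    proof (cases p)
      case (Cons x q)
      have "ev (0, []) = id" by (simp add: ev_def)
      then show ?thesis
        using Cons
        by (cases x rule: three_cases) (simp_all add: z_def ev_lift deg uvw dirpow_def)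
    qed simp
  qed
  ultimately show ?thesis
    unfolding balanced_ball_def by (metis (mono_tags, lifting) imageI mem_Collect_eq)
qed

lemma spread_eq_iff: "spread f g h = spread f' g' h' \<longleftrightarrow> f = f' \<and> g = g' \<and> h = h'"
proof
  assume eq: "spread f g h = spread f' g' h'"
  have "spread f g h (x # u) = spread f' g' h' (x # u)" for x u by (simp add: eq)
  from this[of 0] this[of 1] this[of 2] show "f = f' \<and> g = g' \<and> h = h'"
    by (auto simp: fun_eq_iff)
qed simp

lemma finite_balanced_ball: "finite (balanced_ball n)"
  using finite_subset[OF balanced_ball_subset finite_nf_ball] .

lemma card_balanced_ball_cube: "card (balanced_ball n) ^ 3 \<le> card (balanced_ball (6 * n + 3))"
proof -
  let ?B = "balanced_ball n"
  have "card (?B \<times> ?B \<times> ?B) \<le> card (balanced_ball (6 * n + 3))"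
  proof (rule card_inj_on_le[of "\<lambda>(f, g, h). spread f g h"])
    show "inj_on (\<lambda>(f, g, h). spread f g h) (?B \<times> ?B \<times> ?B)"
      by (auto simp: inj_on_def spread_eq_iff)
  qed (auto simp: finite_balanced_ball intro: spread_in_balanced_ball)
  then show ?thesis
    by (simp add: card_cartesian_product power3_eq_cube mult.assoc)
qed

text \<open>The commutator \<open>a t a\<^sup>-\<^sup>1 t\<^sup>-\<^sup>1\<close> is balanced, and it moves the vertex \<open>[1, 0]\<close>.\<close>

lemma card_balanced_ball_2: "2 \<le> card (balanced_ball 2)"
proof -
  define v :: nf where "v = (1, [(True, 2), (False, 0)])"
  have "{ev (0, []), ev v} \<subseteq> balanced_ball 2"
    unfolding balanced_ball_def
    by (auto simp: v_def deg_a_def deg_t_def expo_def intro!: imageI)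
  moreover have "ev (0, []) [1, 0] \<noteq> ev v [1, 0]"
    by (simp add: v_def ev_def expo_def)
  then have "ev (0, []) \<noteq> ev v" by metis
  ultimately show ?thesis
    using card_mono[OF finite_balanced_ball, of "{ev (0, []), ev v}" 2] by simp
qed

text \<open>Cubing starts with at least two elements of length at most \<open>2\<close>; the radius \<open>3 * 6\<^sup>k - 1\<close> absorbs the
  additive constant, as \<open>6 (3 * 6\<^sup>k - 1) + 3 \<le> 3 * 6\<^sup>k\<^sup>+\<^sup>1 - 1\<close>.\<close>

lemma card_balanced_ball_ge: "2 ^ 3 ^ k \<le> card (balanced_ball (3 * 6 ^ k - 1))"
proof (induction k)
  case 0
  then show ?case using card_balanced_ball_2 by (simp add: numeral_2_eq_2)
next
  case (Suc k)
  have "2 ^ 3 ^ Suc k = ((2::nat) ^ 3 ^ k) ^ 3"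
    by (simp add: power_mult[symmetric] mult.commute)
  also have "\<dots> \<le> card (balanced_ball (3 * 6 ^ k - 1)) ^ 3"
    by (intro power_mono Suc) auto
  also have "\<dots> \<le> card (balanced_ball (6 * (3 * 6 ^ k - 1) + 3))"
    by (rule card_balanced_ball_cube)
  also have "\<dots> \<le> card (balanced_ball (3 * 6 ^ Suc k - 1))"
  proof (intro card_mono finite_balanced_ball balanced_ball_mono)
    have "(1::nat) \<le> 6 ^ k" by simp
    then show "6 * (3 * 6 ^ k - 1) + 3 \<le> 3 * 6 ^ Suc k - (1::nat)"
      unfolding power_Suc by linarith
  qed
  finally show ?case .
qed

lemma finite_products: "finite (products n)"
  using finite_subset[OF products_subset_nf_ball finite_nf_ball] .

lemma card_products_mono: "m \<le> n \<Longrightarrow> card (products m) \<le> card (products n)"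
  by (intro card_mono finite_products products_mono)

lemma card_products_ge: "2 ^ 3 ^ k \<le> card (products (6 * 6 ^ k))"
proof -
  have "card (balanced_ball (3 * 6 ^ k - 1)) \<le> card (products (2 * (3 * 6 ^ k - 1) + 1))"
    using balanced_ball_subset nf_ball_subset_products
    by (intro card_mono finite_products) blast
  also have "\<dots> \<le> card (products (6 * 6 ^ k))"
  proof (rule card_products_mono)
    have "(1::nat) \<le> 6 ^ k" by simp
    then show "2 * (3 * 6 ^ k - 1) + 1 \<le> 6 * (6::nat) ^ k" by linarith
  qed
  finally show ?thesis
    using card_balanced_ball_ge[of k] by linarith
qed

text \<open>With \<open>6\<^sup>k \<le> x < 6\<^sup>k\<^sup>+\<^sup>1\<close> the left-hand side is at most \<open>exp (3\<^sup>k\<^sup>+\<^sup>1)\<close>. Since \<open>e \<le> 2\<^sup>3\<close>, one more cubing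
  gives enough elements, and \<open>216 = 6 * 6\<^sup>2\<close>.\<close>

lemma exp_powr_le_growth:
  assumes "x \<ge> 1"
  shows "exp (x powr (ln 3 / ln 6)) \<le> real_arg (\<lambda>n. card (products n)) (216 * x)"
proof -
  define k where "k = nat \<lfloor>log 6 x\<rfloor>"
  have l: "0 \<le> log 6 x" using assms by simp
  then have k: "real k \<le> log 6 x" "log 6 x < real k + 1"
    by (auto simp: k_def)
  have "6 ^ k = 6 powr real k" by (simp add: powr_realpow)
  also have "\<dots> \<le> 6 powr log 6 x" using k by simp
  finally have k6: "6 ^ k \<le> x" using assms by simp
  have "x powr (ln 3 / ln 6) = 3 powr log 6 x"
    using assms by (simp add: powr_def log_def)
  also have "\<dots> \<le> 3 powr real (k + 1)" using k by simp
  also have "\<dots> = 3 ^ (k + 1)" by (rule powr_realpow) simp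
  finally have "exp (x powr (ln 3 / ln 6)) \<le> exp (3 ^ (k + 1))" by simp
  also have "\<dots> = exp 1 ^ 3 ^ (k + 1)"
    by (simp flip: exp_of_nat_mult)
  also have "\<dots> \<le> (2 ^ 3) ^ 3 ^ (k + 1)"
    using exp_le by (intro power_mono) auto
  also have "\<dots> = 2 ^ (3 * 3 ^ (k + 1))"
    by (rule power_mult[symmetric])
  also have "\<dots> = 2 ^ 3 ^ (k + 2)"
    by simp
  also have "\<dots> \<le> real (card (products (6 * 6 ^ (k + 2))))"
    using card_products_ge[of "k + 2"] by (metis of_nat_le_iff of_nat_numeral of_nat_power)
  also have "\<dots> \<le> real_arg (\<lambda>n. card (products n)) (216 * x)"
    unfolding real_arg_def
  proof (intro of_nat_mono card_products_mono)
    have "real (6 * 6 ^ (k + 2)) = 216 * 6 ^ k" by simp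
    also have "\<dots> \<le> 216 * x" using k6 by simp
    finally show "6 * 6 ^ (k + 2) \<le> nat \<lfloor>216 * x\<rfloor>" by (rule le_nat_floor)
  qed
  finally show ?thesis .
qed

section \<open>Solving the recursion\<close>

text \<open>The recursion iterated \<open>k\<close> times, with \<open>m\<close> about \<open>\<epsilon> n\<close> and with \<open>x = \<epsilon>\<close> in the count of words with
  few mispredictions. The exponential rate is \<open>h\<close>, coming from those words, plus \<open>2 (1 - \<epsilon>)\<^sup>k\<close>,
  coming from the trivial bound \<open>6\<^sup>n \<le> exp (2 n)\<close> applied to what remains of the length after \<open>k\<close>
  steps. A product over nine sections multiplies the exponent of the polynomial factor by \<open>9\<close>, and
  the number of profiles adds \<open>9\<close> more; the base \<open>20\<close> leaves room for both. In \<open>D\<close>, the exponent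
  \<open>35 = 27 + 8\<close> contains the rounding \<open>m \<le> \<epsilon> n + 1\<close>, and \<open>243\<close> makes the two terms of the recursion
  small compared with the claimed bound.\<close>

lemma card_nf_ball_iterated:
  fixes \<epsilon> :: real
  assumes \<epsilon>: "0 < \<epsilon>" "\<epsilon> \<le> 1"
  defines "h \<equiv> 8 * \<epsilon> * ln (1 / \<epsilon>) + 5 * \<epsilon>" and "D \<equiv> 243 / \<epsilon> ^ 35"
  shows "real (card (nf_ball n))
    \<le> (D * (real n + 1)) ^ (20 ^ k) * exp ((h + 2 * (1 - \<epsilon>) ^ k) * real n)"
proof (induction k arbitrary: n)
  have lnpos: "0 \<le> ln (1 / \<epsilon>)" using \<epsilon> by simp
  have h: "0 \<le> h" using \<epsilon> lnpos by (simp add: h_def)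
  have D: "243 \<le> D" using \<epsilon> by (simp add: D_def field_simps power_le_one)
  {
    case 0
    have e2: "6 \<le> exp (2::real)"
    proof -
      have "(1 + 2 / real 10) ^ 10 \<le> exp (2::real)"
        by (rule exp_ge_one_plus_x_over_n_power_n) auto
      then show ?thesis by (simp add: power_divide)
    qed
    have "real (card (nf_ball n)) \<le> 3 * (real n + 1) * 6 ^ n"
      by (rule card_nf_ball_le_exp)
    also have "\<dots> \<le> (D * (real n + 1)) * exp ((h + 2) * real n)"
    proof (intro mult_mono)
      have "(6::real) ^ n \<le> exp 2 ^ n" using e2 by (intro power_mono) auto
      also have "\<dots> = exp (2 * real n)" by (simp add: exp_of_nat_mult[symmetric] mult.commute)
      also have "\<dots> \<le> exp ((h + 2) * real n)" using h by (simp add: algebra_simps)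
      finally show "6 ^ n \<le> exp ((h + 2) * real n)" .
    qed (use D in auto)
    finally show ?case by simp
  next
    case (Suc k)
    define \<theta> where "\<theta> = h + 2 * (1 - \<epsilon>) ^ k"
    define \<theta>' where "\<theta>' = h + 2 * (1 - \<epsilon>) ^ Suc k"
    define q :: nat where "q = 20 ^ k"
    define Y where "Y = D * (real n + 1)"
    define m where "m = nat \<lceil>\<epsilon> * real n\<rceil>"
    have \<theta>: "0 \<le> \<theta>" using h \<epsilon> by (simp add: \<theta>_def)
    have "(1 - \<epsilon>) * h \<le> 1 * h" using h \<epsilon> by (intro mult_right_mono) auto
    then have \<theta>': "(1 - \<epsilon>) * \<theta> \<le> \<theta>'" by (simp add: \<theta>_def \<theta>'_def distrib_left)
    have h\<theta>': "h \<le> \<theta>'" using \<epsilon> by (simp add: \<theta>'_def)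
    have Y: "243 * (real n + 1) \<le> Y"
      using D unfolding Y_def by (intro mult_right_mono) auto
    then have Y1: "1 \<le> Y" by (simp add: algebra_simps)
    have q: "1 \<le> q" by (simp add: q_def)
    have m_ge: "\<epsilon> * real n \<le> real m" unfolding m_def by (rule real_nat_ceiling_ge)
    have m_le: "real m \<le> \<epsilon> * real n + 1"
      using \<epsilon> by (simp add: m_def)
    have "\<epsilon> * real n \<le> 1 * real n" using \<epsilon> by (intro mult_right_mono) auto
    then have mn: "m \<le> n"
      by (simp add: m_def ceiling_le_iff nat_le_iff)
    \<comment> \<open>The words with few mispredictions.\<close>
    have low: "3 * (real n + 1) * (1 + 5 * \<epsilon>) ^ n / \<epsilon> ^ (8 * m + 27)
        \<le> Y ^ (9 * q + 9) / 81 * exp (\<theta>' * real n)"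
    proof -
      have "(1 + 5 * \<epsilon>) ^ n \<le> exp (5 * \<epsilon>) ^ n"
        using \<epsilon> by (intro power_mono) auto
      then have 1: "(1 + 5 * \<epsilon>) ^ n \<le> exp (5 * \<epsilon> * real n)"
        by (simp add: exp_of_nat_mult[symmetric] mult.commute)
      have "1 / \<epsilon> ^ (8 * m + 27) = exp (ln (1 / \<epsilon>)) ^ (8 * m + 27)"
        using \<epsilon> by (simp add: power_divide)
      also have "\<dots> = exp (real (8 * m + 27) * ln (1 / \<epsilon>))"
        by (rule exp_of_nat_mult[symmetric])
      also have "\<dots> \<le> exp ((8 * \<epsilon> * real n + 35) * ln (1 / \<epsilon>))"
        using m_le lnpos by (intro exp_mono mult_right_mono) auto
      also have "\<dots> = exp (8 * \<epsilon> * ln (1 / \<epsilon>) * real n) * exp (real 35 * ln (1 / \<epsilon>))"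
        by (simp add: exp_add[symmetric] algebra_simps)
      also have "exp (real 35 * ln (1 / \<epsilon>)) = 1 / \<epsilon> ^ 35"
        using \<epsilon> by (subst exp_of_nat_mult) (simp add: power_divide)
      finally have 2: "1 / \<epsilon> ^ (8 * m + 27) \<le> exp (8 * \<epsilon> * ln (1 / \<epsilon>) * real n) * (1 / \<epsilon> ^ 35)" .
      have "3 * (real n + 1) * (1 + 5 * \<epsilon>) ^ n / \<epsilon> ^ (8 * m + 27)
          = 3 * (real n + 1) * ((1 + 5 * \<epsilon>) ^ n * (1 / \<epsilon> ^ (8 * m + 27)))"
        by simp
      also have "\<dots> \<le> 3 * (real n + 1) * (exp (5 * \<epsilon> * real n)
          * (exp (8 * \<epsilon> * ln (1 / \<epsilon>) * real n) * (1 / \<epsilon> ^ 35)))"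
        using 1 2 \<epsilon> by (intro mult_left_mono mult_mono) auto
      also have "\<dots> = Y / 81 * exp (h * real n)"
      proof -
        have "exp (h * real n) = exp (5 * \<epsilon> * real n) * exp (8 * \<epsilon> * ln (1 / \<epsilon>) * real n)"
          by (simp add: h_def exp_add[symmetric] algebra_simps)
        moreover have "Y / 81 = 3 * (real n + 1) * (1 / \<epsilon> ^ 35)"
        proof -
          define c where "c = 1 / \<epsilon> ^ 35"
          have "D = 243 * c" by (simp add: D_def c_def)
          then have "Y / 81 = 3 * (real n + 1) * c" by (simp add: Y_def)
          then show ?thesis by (simp only: c_def)
        qed
        ultimately show ?thesis by (simp only: mult_ac)
      qed
      also have "\<dots> \<le> Y ^ (9 * q + 9) / 81 * exp (\<theta>' * real n)"
      proof (intro mult_mono divide_right_mono)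
        show "Y \<le> Y ^ (9 * q + 9)" using Y1 by (intro self_le_power) auto
        show "exp (h * real n) \<le> exp (\<theta>' * real n)"
          using h\<theta>' by (simp add: mult_right_mono)
      qed (use Y1 in auto)
      finally show ?thesis .
    qed
    \<comment> \<open>The total length is at most (1 - \<epsilon>) n, and the bounds are exponential in the length, so how it is distributed does not matter.\<close>
    have prod: "(\<Prod>i\<in>UNIV. real (card (nf_ball (l i)))) \<le> Y ^ (9 * q) * exp (\<theta>' * real n)"
      if "l \<in> profiles (n - m)" for l
    proof -
      have sum: "sum l UNIV \<le> n - m" using that by (simp add: profiles_def)
      have li: "l i \<le> n" for i
        using member_le_sum[of i UNIV l] sum by simp
      have "(\<Prod>i\<in>UNIV. real (card (nf_ball (l i)))) \<le> (\<Prod>i\<in>UNIV. Y ^ q * exp (\<theta> * real (l i)))"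
      proof (intro prod_mono conjI)
        fix i
        have "real (card (nf_ball (l i))) \<le> (D * (real (l i) + 1)) ^ q * exp (\<theta> * real (l i))"
          unfolding q_def \<theta>_def by (rule Suc.IH)
        also have "\<dots> \<le> Y ^ q * exp (\<theta> * real (l i))"
          using li[of i] D by (intro mult_right_mono power_mono) (auto simp: Y_def)
        finally show "real (card (nf_ball (l i))) \<le> Y ^ q * exp (\<theta> * real (l i))" .
      qed simp
      also have "\<dots> = (Y ^ q) ^ 9 * exp (\<theta> * real (sum l UNIV))"
        by (simp add: prod.distrib exp_sum[symmetric] sum_distrib_left)
      also have "\<dots> \<le> (Y ^ q) ^ 9 * exp (\<theta>' * real n)"
      proof (intro mult_left_mono exp_mono)
        have "real (sum l UNIV) \<le> real n - real m"
          using sum mn by linarith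
        also have "\<dots> \<le> (1 - \<epsilon>) * real n" using m_ge by (simp add: algebra_simps)
        finally have "\<theta> * real (sum l UNIV) \<le> \<theta> * ((1 - \<epsilon>) * real n)"
          using \<theta> by (intro mult_left_mono) auto
        also have "\<dots> = ((1 - \<epsilon>) * \<theta>) * real n" by simp
        also have "\<dots> \<le> \<theta>' * real n" using \<theta>' by (intro mult_right_mono) auto
        finally show "\<theta> * real (sum l UNIV) \<le> \<theta>' * real n" .
      qed (use Y1 in auto)
      also have "(Y ^ q) ^ 9 = Y ^ (9 * q)"
        by (simp add: power_mult[symmetric] mult.commute)
      finally show ?thesis .
    qed
    have "81 * (\<Sum>l\<in>profiles (n - m). \<Prod>i\<in>UNIV. real (card (nf_ball (l i))))
        \<le> 81 * (\<Sum>l\<in>profiles (n - m). Y ^ (9 * q) * exp (\<theta>' * real n))"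
      using prod by (intro mult_left_mono sum_mono) auto
    also have "\<dots> = 81 * real (card (profiles (n - m))) * (Y ^ (9 * q) * exp (\<theta>' * real n))"
      by simp
    also have "\<dots> \<le> (Y ^ 9 / 3) * (Y ^ (9 * q) * exp (\<theta>' * real n))"
    proof (rule mult_right_mono)
      have "real (card (profiles (n - m))) \<le> (real (n - m) + 1) ^ 9"
        by (rule card_profiles_le)
      also have "\<dots> \<le> (real n + 1) ^ 9" by (intro power_mono) auto
      finally have "81 * real (card (profiles (n - m))) \<le> 243 ^ 9 / 3 * (real n + 1) ^ 9"
        by (simp add: mult_mono)
      also have "\<dots> = (243 * (real n + 1)) ^ 9 / 3"
        unfolding power_mult_distrib by simp
      also have "\<dots> \<le> Y ^ 9 / 3"
        using Y by (intro divide_right_mono power_mono) auto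
      finally show "81 * real (card (profiles (n - m))) \<le> Y ^ 9 / 3" .
    qed (use Y1 in auto)
    also have "\<dots> = Y ^ (9 * q + 9) / 3 * exp (\<theta>' * real n)"
      by (simp add: power_add)
    finally have high: "81 * (\<Sum>l\<in>profiles (n - m). \<Prod>i\<in>UNIV. real (card (nf_ball (l i))))
        \<le> Y ^ (9 * q + 9) / 3 * exp (\<theta>' * real n)" .
    have "real (card (nf_ball n))
        \<le> Y ^ (9 * q + 9) / 81 * exp (\<theta>' * real n) + Y ^ (9 * q + 9) / 3 * exp (\<theta>' * real n)"
      using card_nf_ball_recursion[OF \<epsilon> mn] low high by linarith
    also have "\<dots> = (28 / 81) * (Y ^ (9 * q + 9) * exp (\<theta>' * real n))"
      by (simp add: field_simps)
    also have "\<dots> \<le> 1 * (Y ^ (9 * q + 9) * exp (\<theta>' * real n))"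
      using Y1 by (intro mult_right_mono) auto
    also have "\<dots> \<le> Y ^ (20 * q) * exp (\<theta>' * real n)"
      using Y1 q by (auto intro!: mult_right_mono power_increasing)
    finally show ?case by (simp add: Y_def \<theta>'_def q_def)
  }
qed

text \<open>The choice \<open>k \<approx> ln x / 10\<close> gives \<open>20\<^sup>k \<le> sqrt x\<close>, so the polynomial factor contributes only about
  \<open>sqrt x\<close> up to logarithms to the exponent. The choice \<open>\<epsilon> = 11 ln (ln x) / ln x\<close> gives
  \<open>\<epsilon> k \<ge> ln (ln x)\<close>, hence \<open>(1 - \<epsilon>)\<^sup>k \<le> 1 / ln x\<close>. The dominant term is \<open>8 \<epsilon> ln (1/\<epsilon>) x\<close>, which is at
  most \<open>88 x (ln (ln x))\<^sup>2 / ln x\<close>.\<close>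

lemma card_nf_ball_le_subexp:
  "\<forall>\<^sub>F x in at_top. real (card (nf_ball (nat \<lfloor>x\<rfloor>))) \<le> exp (100 * x * (ln (ln x))\<^sup>2 / ln x)"
proof -
  define \<epsilon> :: "real \<Rightarrow> real" where "\<epsilon> = (\<lambda>x. 11 * ln (ln x) / ln x)"
  have ev: "\<forall>\<^sub>F x::real in at_top. 0 < \<epsilon> x" "\<forall>\<^sub>F x::real in at_top. \<epsilon> x \<le> 1"
    "\<forall>\<^sub>F x::real in at_top. ln (ln x) \<le> \<epsilon> x * (ln x / 10 - 1)"
    "\<forall>\<^sub>F x::real in at_top. 0 < ln x"
    "\<forall>\<^sub>F x::real in at_top. sqrt x * (ln 243 + 35 * ln (1 / \<epsilon> x) + ln (x + 1))
       + (8 * \<epsilon> x * ln (1 / \<epsilon> x) + 5 * \<epsilon> x + 2 / ln x) * x \<le> 100 * x * (ln (ln x))\<^sup>2 / ln x"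
    unfolding \<epsilon>_def by real_asymp+
  show ?thesis
    using ev eventually_ge_at_top[of 1]
  proof eventually_elim
    case (elim x)
    define n where "n = nat \<lfloor>x\<rfloor>"
    define k where "k = nat \<lfloor>ln x / 10\<rfloor>"
    let ?e = "\<epsilon> x"
    let ?D = "243 / ?e ^ 35" and ?h = "8 * ?e * ln (1 / ?e) + 5 * ?e"
    have nx: "real n \<le> x" using elim by (simp add: n_def)
    have k: "real k \<le> ln x / 10" "ln x / 10 - 1 \<le> real k"
      using elim by (simp_all add: k_def) linarith+
    have lnpos: "0 \<le> ln (1 / ?e)" using elim by simp
    have D: "1 \<le> ?D" using elim power_le_one[of ?e 35] by (simp add: field_simps)
    have "(20::real) ^ k \<le> (2 ^ 5) ^ k" by (intro power_mono) auto
    also have "\<dots> \<le> (exp 1 ^ 5) ^ k"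
      using exp_ge_add_one_self[of 1] by (intro power_mono) auto
    also have "\<dots> = exp (5 * real k)"
      by (simp add: exp_of_nat_mult[symmetric] mult.commute)
    also have "\<dots> \<le> exp (ln x / 2)" using k by simp
    also have "\<dots> = sqrt x"
      using elim by (simp add: ln_sqrt[symmetric])
    finally have k20: "20 ^ k \<le> sqrt x" .
    have "(1 - ?e) ^ k \<le> exp (- ?e) ^ k"
      using elim exp_ge_add_one_self[of "- ?e"] by (intro power_mono) auto
    also have "\<dots> = exp (- (?e * real k))"
      by (simp add: exp_of_nat_mult[symmetric] mult.commute)
    also have "\<dots> \<le> exp (- ln (ln x))"
    proof -
      have "?e * (ln x / 10 - 1) \<le> ?e * real k"
        using elim k by (intro mult_left_mono) auto
      then have "ln (ln x) \<le> ?e * real k" by (rule order_trans[OF elim(3)])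
      then show ?thesis by simp
    qed
    also have "\<dots> = 1 / ln x" using elim by (simp add: exp_minus field_simps)
    finally have pk: "(1 - ?e) ^ k \<le> 1 / ln x" .
    have "real (card (nf_ball n))
        \<le> (?D * (real n + 1)) ^ (20 ^ k) * exp ((?h + 2 * (1 - ?e) ^ k) * real n)"
      using elim by (intro card_nf_ball_iterated) auto
    also have "\<dots> \<le> (?D * (x + 1)) ^ (20 ^ k) * exp ((?h + 2 / ln x) * x)"
    proof (rule mult_mono)
      show "(?D * (real n + 1)) ^ (20 ^ k) \<le> (?D * (x + 1)) ^ (20 ^ k)"
        using D nx elim by (intro power_mono mult_left_mono) auto
      have "0 \<le> ?h" using elim lnpos by simp
      then have "(?h + 2 * (1 - ?e) ^ k) * real n \<le> (?h + 2 / ln x) * x"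
        using elim pk nx by (intro mult_mono) auto
      then show "exp ((?h + 2 * (1 - ?e) ^ k) * real n) \<le> exp ((?h + 2 / ln x) * x)" by simp
    qed (use D elim in auto)
    also have "(?D * (x + 1)) ^ (20 ^ k) = exp (20 ^ k * ln (?D * (x + 1)))"
    proof -
      have "0 < ?D * (x + 1)" using D elim by (intro mult_pos_pos) auto
      then have "(?D * (x + 1)) ^ (20 ^ k) = exp (ln (?D * (x + 1))) ^ (20 ^ k)" by simp
      also have "\<dots> = exp (real (20 ^ k) * ln (?D * (x + 1)))"
        by (rule exp_of_nat_mult[symmetric])
      finally show ?thesis by simp
    qed
    also have "ln (?D * (x + 1)) = ln 243 + 35 * ln (1 / ?e) + ln (x + 1)"
    proof -
      have "ln (?D * (x + 1)) = ln ?D + ln (x + 1)"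
        by (rule ln_mult_pos) (use elim D in auto)
      then show ?thesis
        using elim by (simp add: ln_div ln_realpow)
    qed
    also have "exp (20 ^ k * (ln 243 + 35 * ln (1 / ?e) + ln (x + 1))) * exp ((?h + 2 / ln x) * x)
        \<le> exp (sqrt x * (ln 243 + 35 * ln (1 / ?e) + ln (x + 1))) * exp ((?h + 2 / ln x) * x)"
      using k20 lnpos elim by (intro mult_right_mono exp_mono) auto
    also have "\<dots> \<le> exp (100 * x * (ln (ln x))\<^sup>2 / ln x)"
      using elim by (simp add: exp_add[symmetric])
    finally show ?case by (simp add: n_def)
  qed
qed

theorem theorem1p1:
  fixes \<gamma> :: "nat \<Rightarrow> nat"
  defines "\<gamma> \<equiv> growth Fabrykowski_Gupta {fg_a, fg_t}"
  shows "intermediate_growth \<gamma> \<and>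
    (\<lambda>x. exp (x powr (ln 3 / ln 6))) \<lesssim> real_arg \<gamma> \<and>
    real_arg \<gamma> \<lesssim> (\<lambda>x. exp (x * (ln (ln x))\<^sup>2 / ln x))"
proof -
  have \<gamma>: "\<gamma> = (\<lambda>n. card (products n))"
    by (rule ext) (simp add: \<gamma>_def growth_eq_card_products)
  have lower: "exp (x powr (ln 3 / ln 6)) \<le> real_arg \<gamma> (216 * x)" if "x \<ge> 1" for x
    using exp_powr_le_growth[OF that] by (simp add: \<gamma>)
  have upper: "\<forall>\<^sub>F x in at_top. real_arg \<gamma> x \<le> exp (100 * x * (ln (ln x))\<^sup>2 / ln x)"
    using card_nf_ball_le_subexp
  proof eventually_elim
    case (elim x)
    have "real_arg \<gamma> x \<le> real (card (nf_ball (nat \<lfloor>x\<rfloor>)))"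
      unfolding real_arg_def \<gamma>
      by (intro of_nat_mono card_mono finite_nf_ball products_subset_nf_ball)
    then show ?case using elim by linarith
  qed
  have "(\<lambda>x. exp (x powr (ln 3 / ln 6))) \<lesssim> real_arg \<gamma>"
    unfolding lesssim_def
    using lower by (intro exI[of _ 216]) (auto intro: eventually_mono[OF eventually_ge_at_top[of 1]])
  moreover have "real_arg \<gamma> \<lesssim> (\<lambda>x. exp (x * (ln (ln x))\<^sup>2 / ln x))"
    unfolding lesssim_def
  proof (intro exI[of _ 200] conjI)
    have "\<forall>\<^sub>F x::real in at_top. 100 * x * (ln (ln x))\<^sup>2 / ln x
        \<le> (200 * x) * (ln (ln (200 * x)))\<^sup>2 / ln (200 * x)"
      by real_asymp
    with upper show "\<forall>\<^sub>F x in at_top. real_arg \<gamma> x \<le> exp ((200 * x) * (ln (ln (200 * x)))\<^sup>2 / ln (200 * x))"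
    proof eventually_elim
      case (elim x)
      then show ?case by (meson exp_le_cancel_iff order_trans)
    qed
  qed simp
  moreover have "(\<lambda>n. real n ^ d) \<in> o(\<lambda>n. real (\<gamma> n))" for d
  proof -
    have "(\<lambda>n. real n ^ d) \<in> o(\<lambda>n. exp ((real n / 216) powr (1 / 2)))"
      by real_asymp
    moreover have "(\<lambda>n. exp ((real n / 216) powr (1 / 2))) \<in> O(\<lambda>n. real (\<gamma> n))"
    proof (rule landau_o.big_mono, rule eventually_mono[OF eventually_ge_at_top[of 216]])
      fix n :: nat
      assume n: "216 \<le> n"
      \<comment> \<open>The exponent ln 3 / ln 6 is at least 1/2, as 6 is less than 9; a stretched exponential beats all powers.\<close>
      have "ln (6::real) \<le> ln (3 ^ 2)" by (subst ln_le_cancel_iff) auto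
      also have "\<dots> = 2 * ln 3" by (subst ln_realpow) auto
      finally have "1 / 2 \<le> ln 3 / ln (6::real)" by (simp add: field_simps)
      then have "(real n / 216) powr (1 / 2) \<le> (real n / 216) powr (ln 3 / ln 6)"
        using n by (intro powr_mono) auto
      then have "exp ((real n / 216) powr (1 / 2)) \<le> exp ((real n / 216) powr (ln 3 / ln 6))"
        by simp
      also have "\<dots> \<le> real (\<gamma> n)"
        using lower[of "real n / 216"] n by (simp add: real_arg_def)
      finally show "norm (exp ((real n / 216) powr (1 / 2))) \<le> norm (real (\<gamma> n))"
        by simp
    qed
    ultimately show ?thesis by (rule landau_o.small_big_trans)
  qed
  moreover have "(\<lambda>n. real (\<gamma> n)) \<in> o(\<lambda>n. C ^ n)" if "C > 1" for C :: real
  proof -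
    have "\<forall>\<^sub>F n in sequentially. real (\<gamma> n) \<le> exp (100 * real n * (ln (ln (real n)))\<^sup>2 / ln (real n))"
      using eventually_compose_filterlim[OF upper filterlim_real_sequentially]
      by (simp add: real_arg_def)
    then have "(\<lambda>n. real (\<gamma> n)) \<in> O(\<lambda>n. exp (100 * real n * (ln (ln (real n)))\<^sup>2 / ln (real n)))"
      by (intro landau_o.big_mono) (auto elim: eventually_mono)
    moreover have "(\<lambda>n. exp (100 * real n * (ln (ln (real n)))\<^sup>2 / ln (real n))) \<in> o(\<lambda>n. C ^ n)"
      using that by real_asymp
    ultimately show ?thesis by (rule landau_o.big_small_trans)
  qed
  ultimately show ?thesis
    by (auto simp: intermediate_growth_def)
qed

end
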